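(* Let $(\hat{\mathbf{x}},\hat{\mathbf{y}})$ be an optimal solution to $$\min\ \mathbf{C}^T\mathbf{x}+\underline{\mathbf{c}}^T\mathbf{y}+\|\mathbf{A}^T\mathbf{y}\|_1\ \ \text{s.t.}\ \ \mathbf{H}(\mathbf{y}+\mathbf{x})\ge\mathbf{g},\ \mathbf{x}+\mathbf{y}\le\mathbf{1},\ \mathbf{x}\in\{0,1\}^n,\ \mathbf{y}\ge\mathbf{0}$$ and let $(\mathbf{x}^*,\mathbf{y}^* )$ be an optimal solution to $$\min\ \mathbf{C}^T\mathbf{x}+\underline{\mathbf{c}}^T\mathbf{y}+\|\mathbf{A}^T\mathbf{y}\|_2\ \ \text{s.t.}\ \ \mathbf{H}(\mathbf{y}+\mathbf{x})\ge\mathbf{g},\ \mathbf{x}+\mathbf{y}\le\mathbf{1},\ \mathbf{x}\in\{0,1\}^n,\ \mathbf{y}\ge\mathbf{0}.$$ Then $\textsc{Eval}(\hat{\mathbf{x}})\le\sqrt{n}\cdot\textsc{Eval}(\mathbf{x}^* )$.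
   Context: Let $\mathcal{X}=\{\mathbf{x}\in\{0,1\}^n:\mathbf{H}\mathbf{x}\ge\mathbf{g}\}$ where the polyhedron $\{\mathbf{x}\in\mathbb{R}^n:\mathbf{H}\mathbf{x}\ge\mathbf{g},\ \mathbf{0}\le\mathbf{x}\le\mathbf{1}\}$ is integral. Let $\mathbf{C}\in\mathbb{R}^n_{\ge0}$ be first-stage costs, $\mathcal{R}(\mathbf{x})=\{\mathbf{y}\in\{0,1\}^n:\mathbf{x}+\mathbf{y}\in\mathcal{X}\}$, $\mathcal{X}'=\{\mathbf{x}\in\{0,1\}^n:\mathcal{R}(\mathbf{x})\ne\emptyset\}$. The uncertainty set is ellipsoidal, $\mathcal{U}^{\mathcal{E}}=\{\underline{\mathbf{c}}+\mathbf{A}\boldsymbol{\delta}:\|\boldsymbol{\delta}\|_2\le1\}\subset\mathbb{R}^n_+$ with $\mathbf{A}\in\mathbb{R}^{n\times n}$. For $\mathbf{x}\in\mathcal{X}'$, $\textsc{Eval}(\mathbf{x})=\mathbf{C}^T\mathbf{x}+\max_{\mathbf{c}\in\mathcal{U}^{\mathcal{E}}}\min_{\mathbf{y}\in\mathcal{R}(\mathbf{x})}\mathbf{c}^T\mathbf{y}$. *)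

theory Defs
  imports "HOL-Analysis.Analysis"
begin

definition binary_vectors :: "(real ^ 'n) set" where
  "binary_vectors = {x. \<forall>i. x $ i \<in> {0, 1}}"

definition integer_vectors :: "(real ^ 'n) set" where
  "integer_vectors = {x. \<forall>i. x $ i \<in> \<int>}"

text \<open>The order on \<^typ>\<open>real ^ 'n\<close> is componentwise, and its constant \<open>1\<close> is the all-ones vector.\<close>

definition lp_relaxation :: "real ^ 'n ^ 'm \<Rightarrow> real ^ 'm \<Rightarrow> (real ^ 'n) set" where
  "lp_relaxation H g = {x. H *v x \<ge> g \<and> 0 \<le> x \<and> x \<le> 1}"

text \<open>A polyhedron is integral if it is the convex hull of its integer points.\<close>

definition integral_polyhedron :: "(real ^ 'n) set \<Rightarrow> bool" where
  "integral_polyhedron P \<longleftrightarrow> polyhedron P \<and> convex hull (P \<inter> integer_vectors) = P"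

definition feasible_set :: "real ^ 'n ^ 'm \<Rightarrow> real ^ 'm \<Rightarrow> (real ^ 'n) set" where
  "feasible_set H g = {x \<in> binary_vectors. H *v x \<ge> g}"

definition recourse_set :: "real ^ 'n ^ 'm \<Rightarrow> real ^ 'm \<Rightarrow> real ^ 'n \<Rightarrow> (real ^ 'n) set" where
  "recourse_set H g x = {y \<in> binary_vectors. x + y \<in> feasible_set H g}"

definition first_stage_set :: "real ^ 'n ^ 'm \<Rightarrow> real ^ 'm \<Rightarrow> (real ^ 'n) set" where
  "first_stage_set H g = {x \<in> binary_vectors. recourse_set H g x \<noteq> {}}"

definition ellipsoidal_set :: "real ^ 'n \<Rightarrow> real ^ 'n ^ 'n \<Rightarrow> (real ^ 'n) set" where
  "ellipsoidal_set c A = {c + A *v \<delta> | \<delta>. norm \<delta> \<le> 1}"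

definition recourse_cost :: "real ^ 'n ^ 'm \<Rightarrow> real ^ 'm \<Rightarrow> real ^ 'n \<Rightarrow> real ^ 'n \<Rightarrow> real" where
  "recourse_cost H g x c = Min ((\<lambda>y. c \<bullet> y) ` recourse_set H g x)"

text \<open>The outer maximum is written as a supremum; by the lemma \<open>eval_attained\<close> below it is attained
  for every first-stage solution. Outside \<^const>\<open>first_stage_set\<close> the value is meaningless.\<close>

definition eval_cost ::
  "real ^ 'n ^ 'm \<Rightarrow> real ^ 'm \<Rightarrow> real ^ 'n \<Rightarrow> real ^ 'n \<Rightarrow> real ^ 'n ^ 'n \<Rightarrow> real ^ 'n \<Rightarrow> real" where
  "eval_cost H g C c A x = C \<bullet> x + (SUP c' \<in> ellipsoidal_set c A. recourse_cost H g x c')"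

definition l1_norm :: "real ^ 'n \<Rightarrow> real" where
  "l1_norm v = (\<Sum>i\<in>UNIV. \<bar>v $ i\<bar>)"

definition mixed_feasible :: "real ^ 'n ^ 'm \<Rightarrow> real ^ 'm \<Rightarrow> (real ^ 'n) \<times> (real ^ 'n) \<Rightarrow> bool" where
  "mixed_feasible H g = (\<lambda>(x, y). H *v (y + x) \<ge> g \<and> x + y \<le> 1 \<and> x \<in> binary_vectors \<and> y \<ge> 0)"

text \<open>The objective, parametrised by the norm \<open>N\<close> that is applied to the deviation.\<close>

definition robust_objective ::
  "(real ^ 'n \<Rightarrow> real) \<Rightarrow> real ^ 'n \<Rightarrow> real ^ 'n \<Rightarrow> real ^ 'n ^ 'n \<Rightarrow> (real ^ 'n) \<times> (real ^ 'n) \<Rightarrow> real" where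
  "robust_objective N C c A = (\<lambda>(x, y). C \<bullet> x + c \<bullet> y + N (transpose A *v y))"

text \<open>The following facts show that \<^const>\<open>eval_cost\<close> is well defined where it is used.\<close>

lemma finite_binary_vectors: "finite (binary_vectors :: (real ^ 'n) set)"
proof -
  have "binary_vectors \<subseteq> (\<lambda>S. \<chi> i. if i \<in> S then 1 else (0::real)) ` (UNIV :: 'n set set)"
  proof
    fix x :: "real ^ 'n"
    assume "x \<in> binary_vectors"
    then have "x = (\<chi> i. if i \<in> {i. x $ i = 1} then 1 else 0)"
      by (auto simp: binary_vectors_def vec_eq_iff)
    then show "x \<in> (\<lambda>S. \<chi> i. if i \<in> S then 1 else (0::real)) ` UNIV"
      by blast
  qed
  then show ?thesis
    by (rule finite_subset) simp
qed

lemma finite_recourse_set: "finite (recourse_set H g x)"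
  by (rule finite_subset[OF _ finite_binary_vectors]) (auto simp: recourse_set_def)

lemma continuous_on_Min_inner:
  fixes R :: "'a :: real_inner set"
  assumes "finite R" "R \<noteq> {}"
  shows "continuous_on S (\<lambda>c. Min ((\<lambda>y. c \<bullet> y) ` R))"
  using assms
proof (induction R rule: finite_ne_induct)
  case (insert z R)
  then have "(\<lambda>c. Min ((\<lambda>y. c \<bullet> y) ` insert z R)) = (\<lambda>c. min (c \<bullet> z) (Min ((\<lambda>y. c \<bullet> y) ` R)))"
    by (auto simp: fun_eq_iff)
  then show ?case
    using insert.IH by (simp only:) (intro continuous_intros)
qed (auto intro!: continuous_intros)

lemma eval_attained:
  assumes "x \<in> first_stage_set H g"
  shows "\<exists>w \<in> ellipsoidal_set c A. eval_cost H g C c A x = C \<bullet> x + recourse_cost H g x w \<and>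
           (\<forall>c' \<in> ellipsoidal_set c A. recourse_cost H g x c' \<le> recourse_cost H g x w)"
proof -
  have eq: "ellipsoidal_set c A = (\<lambda>\<delta>. c + A *v \<delta>) ` cball 0 1"
    by (auto simp: ellipsoidal_set_def)
  have comp: "compact (ellipsoidal_set c A)"
    unfolding eq
    by (intro compact_continuous_image continuous_intros matrix_vector_mult_linear_continuous_on compact_cball)
  have ne: "ellipsoidal_set c A \<noteq> {}"
    unfolding eq by simp
  have "continuous_on (ellipsoidal_set c A) (recourse_cost H g x)"
    unfolding recourse_cost_def using assms
    by (intro continuous_on_Min_inner finite_recourse_set) (auto simp: first_stage_set_def)
  from continuous_attains_sup[OF comp ne this] obtain w
    where w: "w \<in> ellipsoidal_set c A"
      "\<And>c'. c' \<in> ellipsoidal_set c A \<Longrightarrow> recourse_cost H g x c' \<le> recourse_cost H g x w"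
    by blast
  then have "(SUP c' \<in> ellipsoidal_set c A. recourse_cost H g x c') = recourse_cost H g x w"
    by (intro cSup_eq_maximum) auto
  with w show ?thesis
    by (auto simp: eval_cost_def)
qed

lemma mixed_feasible_imp_first_stage:
  fixes H :: "real ^ 'n ^ 'm" and x y :: "real ^ 'n"
  assumes int: "integral_polyhedron (lp_relaxation H g)" and feas: "mixed_feasible H g (x, y)"
  shows "x \<in> first_stage_set H g"
proof -
  let ?P = "lp_relaxation H g"
  let ?Z = "?P \<inter> integer_vectors"
  have xb: "x \<in> binary_vectors" and y0: "0 \<le> y" and xy1: "x + y \<le> 1"
    using feas by (auto simp: mixed_feasible_def)
  have x01: "x $ i = 0 \<or> x $ i = 1" for i
    using xb by (auto simp: binary_vectors_def)
  have x0: "0 \<le> x $ i" for i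
    using x01[of i] by auto
  have "x + y \<in> ?P"
    using feas y0 x0 unfolding mixed_feasible_def lp_relaxation_def
    by (auto simp: less_eq_vec_def add.commute)
  then have hull: "x + y \<in> convex hull ?Z"
    using int by (simp add: integral_polyhedron_def)
  have binZ: "z \<in> binary_vectors" if "z \<in> ?Z" for z
  proof -
    have "z $ i \<in> {0, 1}" for i
    proof -
      have "z $ i \<in> \<int>" "0 \<le> z $ i" "z $ i \<le> 1"
        using that by (auto simp: integer_vectors_def lp_relaxation_def less_eq_vec_def)
      then obtain k where "z $ i = of_int k" "0 \<le> k" "k \<le> 1"
        by (auto elim!: Ints_cases)
      then have "k = 0 \<or> k = 1" by auto
      with \<open>z $ i = of_int k\<close> show ?thesis by auto
    qed
    then show ?thesis by (simp add: binary_vectors_def)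
  qed
  let ?s = "\<Sum>i\<in>UNIV. x $ i"
  have "\<exists>z \<in> ?Z. x \<le> z"
  proof (rule ccontr)
    assume no: "\<not> (\<exists>z \<in> ?Z. x \<le> z)"
    have "?Z \<subseteq> {z. x \<bullet> z \<le> ?s - 1}"
    proof clarify
      fix z assume z: "z \<in> ?P" "z \<in> integer_vectors"
      then obtain j where j: "\<not> x $ j \<le> z $ j"
        using no by (auto simp: less_eq_vec_def)
      have zb: "z $ i = 0 \<or> z $ i = 1" for i
        using binZ[of z] z by (auto simp: binary_vectors_def)
      have "z $ j = 0" "x $ j = 1" using j zb[of j] x01[of j] by auto
      have "(\<Sum>i\<in>UNIV. x $ i * z $ i) \<le> (\<Sum>i\<in>UNIV. x $ i - (if i = j then 1 else 0))"
      proof (rule sum_mono)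
        fix i
        show "x $ i * z $ i \<le> x $ i - (if i = j then 1 else 0)"
          using zb[of i] x01[of i] \<open>z $ j = 0\<close> \<open>x $ j = 1\<close> by auto
      qed
      then show "x \<bullet> z \<le> ?s - 1"
        by (simp add: inner_vec_def sum_subtractf)
    qed
    then have "convex hull ?Z \<subseteq> {z. x \<bullet> z \<le> ?s - 1}"
      by (intro hull_minimal convex_halfspace_le)
    with hull have "x \<bullet> (x + y) \<le> ?s - 1" by auto
    moreover have "x \<bullet> (x + y) \<ge> ?s"
      unfolding inner_vec_def
    proof (rule sum_mono)
      fix i
      show "x $ i \<le> x $ i \<bullet> (x + y) $ i"
        using x01[of i] y0 by (auto simp: less_eq_vec_def)
    qed
    ultimately show False by simp
  qed
  then obtain z where z: "z \<in> ?Z" "x \<le> z" by blast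
  have "z - x \<in> binary_vectors"
  proof -
    have "(z - x) $ i \<in> {0, 1}" for i
    proof -
      have "z $ i = 0 \<or> z $ i = 1"
        using binZ[OF z(1)] by (auto simp: binary_vectors_def)
      moreover have "x $ i \<le> z $ i"
        using z(2) by (simp add: less_eq_vec_def)
      ultimately show ?thesis
        using x01[of i] by auto
    qed
    then show ?thesis by (simp add: binary_vectors_def)
  qed
  moreover have "z \<in> feasible_set H g"
    using z binZ by (auto simp: feasible_set_def lp_relaxation_def)
  ultimately have "z - x \<in> recourse_set H g x"
    by (simp add: recourse_set_def)
  then show ?thesis
    using xb by (auto simp: first_stage_set_def)
qed

end

theory Submission
  imports Defs
begin

text \<open>
  For fixed \<open>x\<close>, integrality makes the second-stage polyhedron the convex hull of the recourse set,
  since \<open>x + y \<le> 1\<close> restricts the integral polyhedron to the face on which \<open>z $ i = 1\<close> whenever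
  \<open>x $ i = 1\<close>. By minimax, \<open>eval_cost\<close> is therefore the minimum over this polyhedron of the
  objective with the Euclidean norm; the minimax identity comes from separating the points
  \<open>(transpose A *v y, c \<bullet> y - m)\<close> from the cone \<open>norm v < - s\<close>. Hence \<open>x_star\<close> minimises \<open>eval_cost\<close>, and replacing the
  Euclidean norm by the 1-norm costs at most a factor \<open>sqrt n\<close>.
\<close>

section \<open>The second-stage polyhedron as a face of an integral polyhedron\<close>

lemma integer_point_binary:
  assumes "z \<in> lp_relaxation H g \<inter> integer_vectors"
  shows "z \<in> binary_vectors"
proof -
  have "z $ i \<in> {0, 1}" for i
  proof -
    have "z $ i \<in> \<int>" "0 \<le> z $ i" "z $ i \<le> 1"
      using assms by (auto simp: integer_vectors_def lp_relaxation_def less_eq_vec_def)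
    then obtain k where "z $ i = of_int k" "0 \<le> k" "k \<le> 1"
      by (auto elim!: Ints_cases)
    then have "k = 0 \<or> k = 1" by auto
    with \<open>z $ i = of_int k\<close> show ?thesis by auto
  qed
  then show ?thesis by (simp add: binary_vectors_def)
qed

text \<open>Makes \<open>x\<close> the normal of a supporting hyperplane of the region
  \<open>z \<le> 1\<close>. The bound holds term by term, so equality of the sums forces equality in
  every term.\<close>

lemma inner_binary_le:
  fixes x z :: "real ^ 'n"
  assumes x: "x \<in> binary_vectors" and z: "z \<le> 1"
  shows "x \<bullet> z \<le> x \<bullet> 1" and "x \<bullet> z = x \<bullet> 1 \<Longrightarrow> x $ i = 1 \<Longrightarrow> z $ i = 1"
proof -
  have le: "x $ i * z $ i \<le> x $ i * (1 :: real ^ 'n) $ i" for i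
  proof -
    have "x $ i = 0 \<or> x $ i = 1" "z $ i \<le> 1"
      using x z by (auto simp: binary_vectors_def less_eq_vec_def)
    then show ?thesis by auto
  qed
  show "x \<bullet> z \<le> x \<bullet> 1"
    unfolding inner_vec_def inner_real_def by (intro sum_mono le)
  assume eq: "x \<bullet> z = x \<bullet> 1" and i: "x $ i = 1"
  have "\<forall>i\<in>UNIV. x $ i * z $ i = x $ i * (1 :: real ^ 'n) $ i"
  proof (rule ccontr)
    assume "\<not> ?thesis"
    then have "\<exists>i\<in>UNIV. x $ i * z $ i < x $ i * (1 :: real ^ 'n) $ i"
      using le by (metis less_eq_real_def)
    then have "x \<bullet> z < x \<bullet> 1"
      unfolding inner_vec_def inner_real_def using le by (intro sum_strict_mono_ex1) auto
    with eq show False by simp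
  qed
  with i show "z $ i = 1" by (metis UNIV_I mult_1 one_index)
qed

text \<open>A face of the hull of a compact set is the hull of some of that set's points. Here the
  face through \<open>x + y\<close> is spanned by binary points that are one on the support of
  \<open>x\<close>; subtracting \<open>x\<close> from them leaves recourse vectors.\<close>

lemma mixed_feasible_convex_hull:
  fixes H :: "real ^ 'n ^ 'm" and x y :: "real ^ 'n"
  assumes int: "integral_polyhedron (lp_relaxation H g)" and feas: "mixed_feasible H g (x, y)"
  shows "y \<in> convex hull recourse_set H g x"
proof -
  let ?Z = "lp_relaxation H g \<inter> integer_vectors"
  let ?F = "convex hull ?Z \<inter> {z. x \<bullet> z = x \<bullet> 1}"
  have xb: "x \<in> binary_vectors" and y0: "0 \<le> y" and xy1: "x + y \<le> 1"
    using feas by (auto simp: mixed_feasible_def)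
  have x01: "x $ i = 0 \<or> x $ i = 1" for i
    using xb by (auto simp: binary_vectors_def)
  then have x0: "0 \<le> x $ i" for i
    by (metis order.refl zero_le_one)
  have hull: "convex hull ?Z = lp_relaxation H g"
    using int by (simp add: integral_polyhedron_def)
  have "x + y \<in> lp_relaxation H g"
    using feas y0 x0 unfolding mixed_feasible_def lp_relaxation_def
    by (auto simp: less_eq_vec_def add.commute)
  \<comment> \<open>Where \<open>x $ i = 1\<close>, the constraints \<open>0 \<le> y\<close> and
    \<open>x + y \<le> 1\<close> force \<open>y $ i = 0\<close>.\<close>
  moreover have "x \<bullet> (x + y) = x \<bullet> 1"
    unfolding inner_vec_def
  proof (rule sum.cong)
    fix i
    have "0 \<le> y $ i" "x $ i + y $ i \<le> 1"
      using y0 xy1 by (simp_all add: less_eq_vec_def)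
    then show "x $ i \<bullet> (x + y) $ i = x $ i \<bullet> (1 :: real ^ 'n) $ i"
      using x01[of i] by auto
  qed simp
  ultimately have mem: "x + y \<in> ?F"
    using hull by simp
  have "x \<bullet> z \<le> x \<bullet> 1" if "z \<in> convex hull ?Z" for z
    using that unfolding hull by (intro inner_binary_le(1)[OF xb]) (simp add: lp_relaxation_def)
  then have "?F face_of convex hull ?Z"
    by (intro face_of_Int_supporting_hyperplane_le convex_convex_hull)
  moreover have "compact ?Z"
    by (intro finite_imp_compact finite_subset[OF _ finite_binary_vectors])
      (use integer_point_binary in blast)
  ultimately obtain S where S: "S \<subseteq> ?Z" "?F = convex hull S"
    by (metis face_of_convex_hull_subset)
  have "S \<subseteq> (+) x ` recourse_set H g x"
  proof
    fix z assume z: "z \<in> S"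
    then have zb: "z \<in> binary_vectors" and zZ: "z \<in> ?Z"
      using S(1) integer_point_binary by blast+
    have "x \<bullet> z = x \<bullet> 1"
      using z S(2) hull_subset[of S convex] by blast
    then have one: "x $ i = 1 \<Longrightarrow> z $ i = 1" for i
      using inner_binary_le(2)[OF xb] zZ by (auto simp: lp_relaxation_def)
    have "(z - x) $ i \<in> {0, 1}" for i
      using x01[of i] one[of i] zb by (auto simp: binary_vectors_def)
    then have "z - x \<in> recourse_set H g x"
      using zZ zb by (auto simp: recourse_set_def binary_vectors_def feasible_set_def lp_relaxation_def)
    then show "z \<in> (+) x ` recourse_set H g x"
      by (intro image_eqI[of _ _ "z - x"]) auto
  qed
  then have "x + y \<in> convex hull ((+) x ` recourse_set H g x)"
    using mem S(2) hull_mono by blast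
  then show ?thesis
    by (auto simp: convex_hull_translation)
qed

section \<open>Minimax for a fixed first-stage solution\<close>

lemma recourse_cost_le:
  assumes "y \<in> convex hull recourse_set H g x"
  shows "recourse_cost H g x w \<le> w \<bullet> y"
proof -
  have "convex hull recourse_set H g x \<subseteq> {y. recourse_cost H g x w \<le> w \<bullet> y}"
    by (intro hull_minimal convex_halfspace_ge)
      (auto simp: recourse_cost_def finite_recourse_set)
  with assms show ?thesis by blast
qed

lemma recourse_set_mixed_feasible:
  assumes "x \<in> binary_vectors" "y \<in> recourse_set H g x"
  shows "mixed_feasible H g (x, y)"
  using assms
  by (auto simp: mixed_feasible_def recourse_set_def feasible_set_def binary_vectors_def
      less_eq_vec_def add.commute) (metis order.refl zero_le_one)+

lemma convex_mixed_feasible: "convex {y. mixed_feasible H g (x, y)}"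
proof -
  \<comment> \<open>For fixed \<open>x\<close>, each constraint on \<open>y\<close> is a lower bound
    on an affine function, the upper bound \<open>x + y \<le> 1\<close> after negation, so this one
    fact serves all of them.\<close>
  have *: "r \<le> u *\<^sub>R b + v *\<^sub>R b'" if "r \<le> b" "r \<le> b'" "0 \<le> u" "0 \<le> v" "u + v = 1"
    for u v :: real and b b' r :: "real ^ 'k"
    using add_mono[OF scaleR_left_mono[OF that(1,3)] scaleR_left_mono[OF that(2,4)]] that(5)
    by (simp flip: scaleR_left_distrib)
  show ?thesis
  proof (rule convexI)
    fix a b and u v :: real
    assume ab: "a \<in> {y. mixed_feasible H g (x, y)}" "b \<in> {y. mixed_feasible H g (x, y)}"
      and uv: "0 \<le> u" "0 \<le> v" "u + v = 1"
    let ?y = "u *\<^sub>R a + v *\<^sub>R b"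
    have x: "x = u *\<^sub>R x + v *\<^sub>R x"
      using uv by (simp flip: scaleR_left_distrib)
    have "?y + x = u *\<^sub>R (a + x) + v *\<^sub>R (b + x)"
      by (subst x) (simp add: scaleR_right_distrib)
    then have "g \<le> H *v (?y + x)"
      using ab uv *[of g "H *v (a + x)" "H *v (b + x)" u v]
      by (simp add: mixed_feasible_def matrix_vector_right_distrib matrix_vector_mult_scaleR)
    moreover have "0 \<le> ?y"
      using ab uv by (simp add: mixed_feasible_def *)
    moreover have "- (1 - x) \<le> u *\<^sub>R - a + v *\<^sub>R - b"
      using ab uv by (intro *) (auto simp: mixed_feasible_def algebra_simps)
    then have "x + ?y \<le> 1"
      by (simp add: algebra_simps)
    ultimately show "?y \<in> {y. mixed_feasible H g (x, y)}"
      using ab by (simp add: mixed_feasible_def)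
  qed
qed

text \<open>The norm is the maximum of \<open>\<delta> \<bullet> v\<close> over the unit ball, so
  the hypothesis allows a different scenario for each \<open>y\<close>. The normal of a separating
  hyperplane yields a single scenario for all of \<open>K\<close>.\<close>

lemma minimax_deviation:
  fixes A :: "real ^ 'n ^ 'n" and c :: "real ^ 'n"
  assumes K: "convex K" and ne: "K \<noteq> {}"
    and m: "\<And>y. y \<in> K \<Longrightarrow> m \<le> c \<bullet> y + norm (transpose A *v y)"
  obtains w where "w \<in> ellipsoidal_set c A" "\<And>y. y \<in> K \<Longrightarrow> m \<le> w \<bullet> y"
proof -
  define D where "D = (\<lambda>y. (transpose A *v y, c \<bullet> y - m)) ` K"
  define E where "E = {p :: (real ^ 'n) \<times> real. norm (fst p) < - snd p}"
  have "convex D"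
  proof -
    have "D = (+) (0, - m) ` (\<lambda>y. (transpose A *v y, c \<bullet> y)) ` K"
      by (auto simp: D_def image_image)
    moreover have "linear (\<lambda>y. (transpose A *v y, c \<bullet> y))"
      by (auto intro!: linearI simp: matrix_vector_right_distrib inner_right_distrib
          matrix_vector_mult_scaleR simp del: transpose_matrix_vector)
    ultimately show ?thesis
      using K by (simp add: convex_linear_image convex_translation)
  qed
  moreover have "convex E"
  proof (rule convexI)
    fix p q :: "(real ^ 'n) \<times> real" and u v :: real
    assume pq: "p \<in> E" "q \<in> E" and uv: "0 \<le> u" "0 \<le> v" "u + v = 1"
    have "norm (u *\<^sub>R fst p + v *\<^sub>R fst q) \<le> u * norm (fst p) + v * norm (fst q)"
      using norm_triangle_ineq[of "u *\<^sub>R fst p" "v *\<^sub>R fst q"] uv by simp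
    \<comment> \<open>Strictness needs a positive weight on a strict inequality: \<open>u\<close>,
      or else \<open>v = 1\<close>.\<close>
    also have "\<dots> < u * - snd p + v * - snd q"
    proof (cases "u = 0")
      case False
      then show ?thesis
        using pq uv by (intro add_less_le_mono mult_strict_left_mono mult_left_mono) (auto simp: E_def)
    qed (use pq uv in \<open>auto simp: E_def\<close>)
    finally show "u *\<^sub>R p + v *\<^sub>R q \<in> E"
      by (simp add: E_def)
  qed
  moreover have "D \<inter> E = {}"
    using m by (force simp: D_def E_def)
  \<comment> \<open>Test points: \<open>t\<close> moves along a boundary ray of the cone, and the
    slack \<open>r\<close> keeps the point strictly inside.\<close>
  moreover have E: "(t *\<^sub>R v, - t * norm v - r) \<in> E" if "0 \<le> t" "0 < r" for t r v
    using that by (simp add: E_def)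
  then have "E \<noteq> {}" by (metis empty_iff order.refl zero_less_one)
  moreover have "D \<noteq> {}" using ne by (simp add: D_def)
  ultimately obtain p \<beta> where p: "p \<noteq> 0" "\<forall>q\<in>E. p \<bullet> q \<le> \<beta>" "\<forall>q\<in>D. \<beta> \<le> p \<bullet> q"
    using separating_hyperplane_sets[of E D] by (metis inf_commute)
  obtain a b where ab: "p = (a, b)" by fastforce
  have bound: "t * (a \<bullet> a - b * norm a) - b * r \<le> \<beta>" if "0 \<le> t" "0 < r" for t r
    using bspec[OF p(2) E[OF that, of a]] by (simp add: ab algebra_simps)
  \<comment> \<open>If \<open>b\<close> were negative, points far down the axis of the cone would
    violate the bound; \<open>r\<close> is chosen to make the left side
    \<open>\<bar>\<beta>\<bar> + 1\<close>.\<close>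
  have b0: "0 \<le> b"
  proof (rule ccontr)
    assume "\<not> 0 \<le> b"
    then have "b < 0" by simp
    then have "0 < (\<bar>\<beta>\<bar> + 1) / (- b)" "- b * ((\<bar>\<beta>\<bar> + 1) / (- b)) = \<bar>\<beta>\<bar> + 1"
      by (simp_all add: divide_less_0_iff)
    then show False
      using bound[of 0 "(\<bar>\<beta>\<bar> + 1) / (- b)"] by simp
  qed
  \<comment> \<open>The apex is approached by letting \<open>r\<close> tend to 0; the denominator
    \<open>b + 1\<close> also covers \<open>b = 0\<close>.\<close>
  have \<beta>: "0 \<le> \<beta>"
  proof (rule field_le_epsilon)
    fix e :: real assume e: "0 < e"
    have "- (b * (e / (b + 1))) \<le> \<beta>"
      using bound[of 0 "e / (b + 1)"] b0 e by simp
    moreover have "b * (e / (b + 1)) \<le> e"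
      using b0 e by (simp add: field_simps)
    ultimately show "0 \<le> \<beta> + e" by simp
  qed
  \<comment> \<open>A positive slope along the ray would exceed \<open>\<beta>\<close> for large
    \<open>t\<close>; the chosen \<open>t\<close> gives \<open>\<beta> + 1\<close> at
    \<open>r = 1\<close>.\<close>
  have "a \<bullet> a - b * norm a \<le> 0"
  proof (rule ccontr)
    assume "\<not> ?thesis"
    then show False
      using bound[of "(\<beta> + b + 1) / (a \<bullet> a - b * norm a)" 1] b0 \<beta> by simp
  qed
  then have ab_le: "norm a \<le> b"
    using b0 by (cases "a = 0") (auto simp: dot_square_norm power2_eq_square)
  \<comment> \<open>The hyperplane is not vertical: \<open>b = 0\<close> would give
    \<open>a = 0\<close> and hence \<open>p = 0\<close>. Thus \<open>a\<close> can be scaled by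
    \<open>1 / b\<close> into the unit ball.\<close>
  with p(1) have "0 < b"
    using b0 by (cases "b = 0") (auto simp: ab zero_prod_def)
  let ?w = "c + A *v ((1 / b) *\<^sub>R a)"
  have "?w \<in> ellipsoidal_set c A"
    using ab_le \<open>0 < b\<close> by (auto simp: ellipsoidal_set_def intro!: exI[of _ "(1 / b) *\<^sub>R a"])
  moreover have "m \<le> ?w \<bullet> y" if "y \<in> K" for y
  proof -
    have "0 \<le> a \<bullet> (transpose A *v y) + b * (c \<bullet> y - m)"
      using p(3) \<beta> that by (force simp: D_def ab)
    also have "a \<bullet> (transpose A *v y) = (A *v a) \<bullet> y"
      by (simp add: dot_lmul_matrix inner_commute[of _ y] inner_commute[of a])
    finally show ?thesis
      using \<open>0 < b\<close> by (simp add: inner_left_distrib matrix_vector_mult_scaleR field_simps)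
  qed
  ultimately show ?thesis using that by blast
qed

text \<open>Minimax is applied to all feasible second stages for \<open>x\<close>, with
  \<open>m\<close> the deviation-adjusted cost of \<open>y\<close>. The resulting scenario makes
  every recourse vector cost at least \<open>m\<close>, and the worst scenario is no
  cheaper.\<close>

lemma robust_objective_le_eval_cost:
  assumes x: "x \<in> first_stage_set H g"
    and opt: "\<And>z. mixed_feasible H g (x, z) \<Longrightarrow> robust_objective norm C c A (x, y) \<le> robust_objective norm C c A (x, z)"
  shows "robust_objective norm C c A (x, y) \<le> eval_cost H g C c A x"
proof -
  let ?m = "c \<bullet> y + norm (transpose A *v y)"
  let ?K = "{z. mixed_feasible H g (x, z)}"
  have sub: "recourse_set H g x \<subseteq> ?K" and ne: "recourse_set H g x \<noteq> {}"
    using x recourse_set_mixed_feasible by (auto simp: first_stage_set_def)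
  have "?m \<le> c \<bullet> z + norm (transpose A *v z)" if "z \<in> ?K" for z
    using opt[of z] that by (simp add: robust_objective_def)
  then obtain w where w: "w \<in> ellipsoidal_set c A" "\<And>z. z \<in> ?K \<Longrightarrow> ?m \<le> w \<bullet> z"
    using minimax_deviation[OF convex_mixed_feasible, of H g x ?m c A] sub ne by blast
  have "?m \<le> recourse_cost H g x w"
    unfolding recourse_cost_def using w(2) sub ne by (auto simp: finite_recourse_set)
  moreover obtain w' where "eval_cost H g C c A x = C \<bullet> x + recourse_cost H g x w'"
    "recourse_cost H g x w \<le> recourse_cost H g x w'"
    using eval_attained[OF x] w(1) by metis
  ultimately show ?thesis
    by (simp add: robust_objective_def)
qed

text \<open>The weak direction of minimax: a possibly fractional \<open>y\<close> lies in the hull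
  of the recourse set, so it costs at least the cheapest recourse in the worst scenario;
  Cauchy-Schwarz bounds that scenario's deviation.\<close>

lemma eval_cost_le_robust_objective:
  fixes x y :: "real ^ 'n"
  assumes int: "integral_polyhedron (lp_relaxation H g)" and feas: "mixed_feasible H g (x, y)"
  shows "eval_cost H g C c A x \<le> robust_objective norm C c A (x, y)"
proof -
  obtain w where w: "w \<in> ellipsoidal_set c A"
    and eq: "eval_cost H g C c A x = C \<bullet> x + recourse_cost H g x w"
    using eval_attained[OF mixed_feasible_imp_first_stage[OF assms]] by metis
  obtain \<delta> where \<delta>: "w = c + A *v \<delta>" "norm \<delta> \<le> 1"
    using w by (auto simp: ellipsoidal_set_def)
  have "recourse_cost H g x w \<le> w \<bullet> y"
    by (intro recourse_cost_le mixed_feasible_convex_hull assms)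
  also have "\<dots> = c \<bullet> y + \<delta> \<bullet> (transpose A *v y)"
    by (simp add: \<delta> inner_right_distrib inner_commute[of _ y] inner_commute[of \<delta>] dot_lmul_matrix)
  also have "\<delta> \<bullet> (transpose A *v y) \<le> norm \<delta> * norm (transpose A *v y)"
    by (rule norm_cauchy_schwarz)
  also have "\<dots> \<le> norm (transpose A *v y)"
    using \<delta>(2) by (simp add: mult_left_le_one_le)
  finally show ?thesis
    by (simp add: eq robust_objective_def)
qed

section \<open>Norm comparison and the approximation factor\<close>

lemma norm_le_l1_norm: "norm v \<le> l1_norm v"
  by (simp add: l1_norm_def norm_le_l1_cart)

text \<open>Cauchy-Schwarz against the all-ones vector, whose Euclidean norm is the factor.\<close>

lemma l1_norm_le_norm:
  fixes v :: "real ^ 'n"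
  shows "l1_norm v \<le> sqrt (real CARD('n)) * norm v"
  using L2_set_mult_ineq[of "\<lambda>i. \<bar>v $ i\<bar>" "\<lambda>_. 1" UNIV]
  by (simp add: l1_norm_def norm_vec_def L2_set_def mult.commute)

lemma is_arg_min_le:
  fixes f :: "'a \<Rightarrow> 'b :: linorder"
  assumes "is_arg_min f P z" "P w"
  shows "f z \<le> f w"
  using assms by (auto simp: is_arg_min_linorder)

theorem theorem10:
  fixes H :: "real ^ 'n ^ 'm" and g :: "real ^ 'm"
    and C c :: "real ^ 'n" and A :: "real ^ 'n ^ 'n"
    and x_hat y_hat x_star y_star :: "real ^ 'n"
  assumes "integral_polyhedron (lp_relaxation H g)"
    and "C \<ge> 0"
    and "ellipsoidal_set c A \<subseteq> {v. v \<ge> 0}"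
    and "is_arg_min (robust_objective l1_norm C c A) (mixed_feasible H g) (x_hat, y_hat)"
    and "is_arg_min (robust_objective norm C c A) (mixed_feasible H g) (x_star, y_star)"
  shows "eval_cost H g C c A x_hat \<le> sqrt (real CARD('n)) * eval_cost H g C c A x_star"
proof -
  let ?s = "sqrt (real CARD('n))"
  let ?N = "\<lambda>y. norm (transpose A *v y)"
  have feas_hat: "mixed_feasible H g (x_hat, y_hat)"
    and feas_star: "mixed_feasible H g (x_star, y_star)"
    using assms(4,5) by (auto simp: is_arg_min_def)
  have s: "1 \<le> ?s" by (simp add: Suc_leI)
  \<comment> \<open>The centre is the scenario with zero deviation, so it inherits nonnegativity
    from the uncertainty set.\<close>
  have "c \<in> ellipsoidal_set c A"
    by (auto simp: ellipsoidal_set_def intro!: exI[of _ 0])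
  then have "0 \<le> c" using assms(3) by blast
  have "0 \<le> x_star" "0 \<le> y_star"
    using feas_star by (auto simp: mixed_feasible_def binary_vectors_def less_eq_vec_def)
      (metis order.refl zero_le_one)
  then have "0 \<le> C \<bullet> x_star + c \<bullet> y_star"
    using \<open>0 \<le> c\<close> assms(2) by (simp add: inner_nonneg_nonneg)
  \<comment> \<open>The norm comparison scales only the deviation term; nonnegativity of the nominal
    cost lets the factor cover the whole objective.\<close>
  then have cost: "C \<bullet> x_star + c \<bullet> y_star \<le> ?s * (C \<bullet> x_star + c \<bullet> y_star)"
    using s by (simp add: mult_le_cancel_right1)
  have "eval_cost H g C c A x_hat \<le> robust_objective norm C c A (x_hat, y_hat)"
    by (rule eval_cost_le_robust_objective[OF assms(1) feas_hat])
  also have "\<dots> \<le> robust_objective l1_norm C c A (x_hat, y_hat)"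
    by (simp add: robust_objective_def norm_le_l1_norm)
  also have "\<dots> \<le> robust_objective l1_norm C c A (x_star, y_star)"
    by (rule is_arg_min_le[OF assms(4) feas_star])
  also have "\<dots> \<le> C \<bullet> x_star + c \<bullet> y_star + ?s * ?N y_star"
    by (simp add: robust_objective_def l1_norm_le_norm)
  also have "\<dots> \<le> ?s * robust_objective norm C c A (x_star, y_star)"
    using cost by (simp add: robust_objective_def distrib_left)
  also have "\<dots> \<le> ?s * eval_cost H g C c A x_star"
  proof (rule mult_left_mono)
    show "robust_objective norm C c A (x_star, y_star) \<le> eval_cost H g C c A x_star"
      \<comment> \<open>Joint optimality of the pair is specialised to second stages sharing the
        same \<open>x_star\<close>.\<close>
      by (rule robust_objective_le_eval_cost[OF mixed_feasible_imp_first_stage[OF assms(1) feas_star]])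
        (rule is_arg_min_le[OF assms(5)])
  qed simp
  finally show ?thesis .
qed

end
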